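(* The theory $\mathsf{DU}$ is strongly $\overline{GH}$-$\omega$-categorical, where $GH=\{d(x,y)\}$; that is, for any two separable models $M,N\models\mathsf{DU}$, $\rho_{\overline{GH}}(M;N)=0$.
   Context: Continuous logic in the empty metric language. $\mathsf{DU}$ is the theory of ultrametric spaces (complete, diameter $\le 1$) such that for every point $a$ the set $\{d(a,b)\}$ is dense in $[0,1]$; axiomatically, the ultrametric axiom plus $\sup_x\inf_y|d(x,y)-p|=0$ for each rational $p\in[0,1]$. For a set of formulas $\Delta$ and a theory $T$, $\overline{\Delta}$ is the closure of $\Delta$ under renaming variables, quantification ($\sup$, $\inf$), $1$-Lipschitz connectives, logical equivalence modulo $T$, and uniform limits. A correlation between structures $M,N$ is a relation $R\subseteq M\times N$ that is total and surjective. Its distortion is $\mathrm{dis}_\Delta(R)=\sup\{|\phi^M(\bar m)-\phi^N(\bar n)|: \phi\in\Delta,\ \bar m,\bar n \text{ tuples with } (m_i,n_i)\in R \text{ for all } i\}$, and $\rho_\Delta(M;N)=\inf\{\mathrm{dis}_\Delta(R): R \text{ a correlation between } M,N\}$. $T$ is strongly $\Delta$-$\omega$-categorical if $\rho_\Delta(M;N)=0$ for any two models $M,N$ of $T$ of density character $\omega$. *)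

theory Defs
  imports "HOL-Analysis.Analysis"
begin

text \<open>
  Formulas of continuous logic in the empty metric language, with values in the unit interval.
  Variables are de Bruijn indices: \<open>FSup\<close> and \<open>FInf\<close> bind index 0.
  Connectives have countable arity, so that uniform limits of formulas are again formulas (up to
  equivalence); an \<open>n\<close>-ary connective is one that depends on its first \<open>n\<close> arguments only.
\<close>

datatype fm =
    FDist nat nat
  | FConn "(nat \<Rightarrow> real) \<Rightarrow> real" "nat \<Rightarrow> fm"
  | FSup fm
  | FInf fm

definition unit_cube :: "(nat \<Rightarrow> real) set" where
  "unit_cube = {x. \<forall>i. x i \<in> {0..1}}"

text \<open>Continuity is with respect to the product topology, the topology of the type
  \<^typ>\<open>nat \<Rightarrow> real\<close>.\<close>

definition connective :: "((nat \<Rightarrow> real) \<Rightarrow> real) \<Rightarrow> bool" where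
  "connective F \<longleftrightarrow> continuous_on unit_cube F \<and> F ` unit_cube \<subseteq> {0..1}"

definition lipschitz1_connective :: "((nat \<Rightarrow> real) \<Rightarrow> real) \<Rightarrow> bool" where
  "lipschitz1_connective F \<longleftrightarrow> connective F \<and>
     (\<forall>x\<in>unit_cube. \<forall>y\<in>unit_cube. \<bar>F x - F y\<bar> \<le> (SUP i. \<bar>x i - y i\<bar>))"

primrec wf_fm :: "fm \<Rightarrow> bool" where
  "wf_fm (FDist i j) = True"
| "wf_fm (FConn F \<phi>s) = (connective F \<and> (\<forall>i. wf_fm (\<phi>s i)))"
| "wf_fm (FSup \<phi>) = wf_fm \<phi>"
| "wf_fm (FInf \<phi>) = wf_fm \<phi>"

primrec rename :: "fm \<Rightarrow> (nat \<Rightarrow> nat) \<Rightarrow> fm" where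
  "rename (FDist i j) \<sigma> = FDist (\<sigma> i) (\<sigma> j)"
| "rename (FConn F \<phi>s) \<sigma> = FConn F (\<lambda>i. rename (\<phi>s i) \<sigma>)"
| "rename (FSup \<phi>) \<sigma> = FSup (rename \<phi> (case_nat 0 (Suc \<circ> \<sigma>)))"
| "rename (FInf \<phi>) \<sigma> = FInf (rename \<phi> (case_nat 0 (Suc \<circ> \<sigma>)))"

definition metric_structure :: "'u metric \<Rightarrow> bool" where
  "metric_structure M \<longleftrightarrow> mspace M \<noteq> {} \<and> mcomplete_of M \<and>
     (\<forall>x\<in>mspace M. \<forall>y\<in>mspace M. mdist M x y \<le> 1)"

definition valuations :: "'u metric \<Rightarrow> (nat \<Rightarrow> 'u) set" where
  "valuations M = {v. \<forall>i. v i \<in> mspace M}"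

primrec fm_val :: "'u metric \<Rightarrow> fm \<Rightarrow> (nat \<Rightarrow> 'u) \<Rightarrow> real" where
  "fm_val M (FDist i j) v = mdist M (v i) (v j)"
| "fm_val M (FConn F \<phi>s) v = F (\<lambda>i. fm_val M (\<phi>s i) v)"
| "fm_val M (FSup \<phi>) v = (SUP a\<in>mspace M. fm_val M \<phi> (case_nat a v))"
| "fm_val M (FInf \<phi>) v = (INF a\<in>mspace M. fm_val M \<phi> (case_nat a v))"

text \<open>A theory is a set of sentences \<open>\<phi>\<close>, each standing for the condition \<open>\<phi> = 0\<close>.\<close>

definition models :: "'u metric \<Rightarrow> fm set \<Rightarrow> bool" where
  "models M T \<longleftrightarrow> metric_structure M \<and> (\<forall>\<phi>\<in>T. \<forall>v\<in>valuations M. fm_val M \<phi> v = 0)"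

text \<open>
  The closure of a set of formulas. The type \<open>'u\<close> is the universe from which the models of \<open>T\<close>
  are taken; by downward Loewenheim-Skolem, any type of at least the cardinality of the continuum
  yields the same closure, and smaller types carry no model of \<open>DU\<close> below. The quantifier rules bind index 0; together with renaming they give quantification
  over an arbitrary variable. A connective of finite arity is applied with its last argument
  repeated.
\<close>

inductive_set fm_closure :: "'u itself \<Rightarrow> fm set \<Rightarrow> fm set \<Rightarrow> fm set"
  for U :: "'u itself" and T :: "fm set" and \<Delta> :: "fm set" where
  base: "\<phi> \<in> \<Delta> \<Longrightarrow> \<phi> \<in> fm_closure U T \<Delta>"
| ren: "\<phi> \<in> fm_closure U T \<Delta> \<Longrightarrow> rename \<phi> \<sigma> \<in> fm_closure U T \<Delta>"
| sup: "\<phi> \<in> fm_closure U T \<Delta> \<Longrightarrow> FSup \<phi> \<in> fm_closure U T \<Delta>"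
| inf: "\<phi> \<in> fm_closure U T \<Delta> \<Longrightarrow> FInf \<phi> \<in> fm_closure U T \<Delta>"
| conn: "lipschitz1_connective F \<Longrightarrow> (\<And>i. \<phi>s i \<in> fm_closure U T \<Delta>) \<Longrightarrow>
    FConn F \<phi>s \<in> fm_closure U T \<Delta>"
| equiv: "\<phi> \<in> fm_closure U T \<Delta> \<Longrightarrow> wf_fm \<psi> \<Longrightarrow>
    (\<And>(M :: 'u metric) v. models M T \<Longrightarrow> v \<in> valuations M \<Longrightarrow> fm_val M \<psi> v = fm_val M \<phi> v) \<Longrightarrow>
    \<psi> \<in> fm_closure U T \<Delta>"
| limit: "(\<And>n. \<phi>s n \<in> fm_closure U T \<Delta>) \<Longrightarrow> wf_fm \<psi> \<Longrightarrow>
    uniform_limit {(M :: 'u metric, v). models M T \<and> v \<in> valuations M}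
      (\<lambda>n (M, v). fm_val M (\<phi>s n) v) (\<lambda>(M, v). fm_val M \<psi> v) sequentially \<Longrightarrow>
    \<psi> \<in> fm_closure U T \<Delta>"

definition correlation :: "'a metric \<Rightarrow> 'b metric \<Rightarrow> ('a \<times> 'b) set \<Rightarrow> bool" where
  "correlation M N R \<longleftrightarrow> R \<subseteq> mspace M \<times> mspace N \<and>
     (\<forall>m\<in>mspace M. \<exists>n. (m, n) \<in> R) \<and> (\<forall>n\<in>mspace N. \<exists>m. (m, n) \<in> R)"

definition distortion :: "fm set \<Rightarrow> 'a metric \<Rightarrow> 'b metric \<Rightarrow> ('a \<times> 'b) set \<Rightarrow> ennreal" where
  "distortion \<Delta> M N R =
     Sup {ennreal \<bar>fm_val M \<phi> m - fm_val N \<phi> n\<bar> | \<phi> m n. \<phi> \<in> \<Delta> \<and> (\<forall>i. (m i, n i) \<in> R)}"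

definition rho :: "fm set \<Rightarrow> 'a metric \<Rightarrow> 'b metric \<Rightarrow> ennreal" where
  "rho \<Delta> M N = Inf {distortion \<Delta> M N R | R. correlation M N R}"

definition density_character_omega :: "'u metric \<Rightarrow> bool" where
  "density_character_omega M \<longleftrightarrow> separable_space (mtopology_of M) \<and>
     (\<forall>D \<subseteq> mspace M. mtopology_of M closure_of D = mspace M \<longrightarrow> infinite D)"

definition strongly_omega_categorical :: "'u itself \<Rightarrow> fm set \<Rightarrow> fm set \<Rightarrow> bool" where
  "strongly_omega_categorical U \<Delta> T \<longleftrightarrow>
     (\<forall>(M :: 'u metric) (N :: 'u metric). models M T \<longrightarrow> models N T \<longrightarrow>
        density_character_omega M \<longrightarrow> density_character_omega N \<longrightarrow> rho \<Delta> M N = 0)"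

text \<open>\<open>sup\<^sub>x sup\<^sub>y sup\<^sub>z max 0 (d(x,z) - max (d(x,y)) (d(y,z)))\<close>, where \<open>x, y, z\<close> are the
  indices 2, 1, 0.\<close>

definition ultrametric_axiom :: fm where
  "ultrametric_axiom = FSup (FSup (FSup
     (FConn (\<lambda>t. max 0 (t 0 - max (t 1) (t 2)))
       (\<lambda>i. if i = 0 then FDist 2 0 else if i = 1 then FDist 2 1 else FDist 1 0))))"

definition dense_distance_axiom :: "real \<Rightarrow> fm" where
  "dense_distance_axiom p = FSup (FInf (FConn (\<lambda>t. \<bar>t 0 - p\<bar>) (\<lambda>_. FDist 1 0)))"

definition DU :: "fm set" where
  "DU = insert ultrametric_axiom (dense_distance_axiom ` (\<rat> \<inter> {0..1}))"

definition GH :: "fm set" where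
  "GH = {FDist 0 1}"

end

theory Submission
  imports Defs
begin

text \<open>
  A correlation that distorts distances by at most \<open>\<epsilon>\<close> distorts every formula of the closure of
  \<open>GH\<close> by at most \<open>\<epsilon>\<close>, so it suffices to find, for each \<open>k\<close>, a correlation distorting distances by
  at most \<open>1/k\<close>. In a separable model of \<open>DU\<close> the relations \<open>d(x,y) \<le> j/k\<close> for \<open>1 \<le> j \<le> k\<close> are
  nested equivalence relations, the coarsest of which is trivial and each class of which splits into
  exactly \<open>\<aleph>\<^sub>0\<close> classes of the next finer one. Numbering the subclasses of each class assigns to
  every point an address in \<open>\<nat>\<^bsup>k-1\<^esup>\<close>; all addresses occur, and the addresses of two points determine
  their distance up to \<open>1/k\<close>. Points of the two models are correlated if they have the same address.
\<close>

section \<open>Formulas of the closure under a correlation of small metric distortion\<close>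

lemma fm_val_rename: "fm_val M (rename \<phi> \<sigma>) v = fm_val M \<phi> (v \<circ> \<sigma>)"
proof (induction \<phi> arbitrary: \<sigma> v)
  case (FSup \<phi>)
  have *: "case_nat a v \<circ> case_nat 0 (Suc \<circ> \<sigma>) = case_nat a (v \<circ> \<sigma>)" for a
    by (auto simp: fun_eq_iff split: nat.splits)
  show ?case by (simp only: rename.simps fm_val.simps FSup *)
next
  case (FInf \<phi>)
  have *: "case_nat a v \<circ> case_nat 0 (Suc \<circ> \<sigma>) = case_nat a (v \<circ> \<sigma>)" for a
    by (auto simp: fun_eq_iff split: nat.splits)
  show ?case by (simp only: rename.simps fm_val.simps FInf *)
qed auto

lemma wf_fm_rename: "wf_fm (rename \<phi> \<sigma>) = wf_fm \<phi>"
  by (induction \<phi> arbitrary: \<sigma>) auto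

lemma case_nat_in_valuations:
  "a \<in> mspace M \<Longrightarrow> v \<in> valuations M \<Longrightarrow> case_nat a v \<in> valuations M"
  by (auto simp: valuations_def split: nat.splits)

text \<open>This bound makes the real-valued \<open>SUP\<close> and \<open>INF\<close> over the
  universe well behaved and places the arguments of a connective in \<open>unit_cube\<close>, where
  its hypotheses apply.\<close>

lemma fm_val_unit_interval:
  assumes "metric_structure M" "wf_fm \<phi>" "v \<in> valuations M"
  shows "fm_val M \<phi> v \<in> {0..1}"
  using assms(2,3)
proof (induction \<phi> arbitrary: v)
  case (FDist i j)
  then show ?case using assms(1) by (auto simp: metric_structure_def valuations_def)
next
  case (FConn F \<phi>s)
  then have "(\<lambda>i. fm_val M (\<phi>s i) v) \<in> unit_cube" by (auto simp: unit_cube_def)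
  with FConn show ?case by (auto simp: connective_def)
next
  case (FSup \<phi>)
  then have *: "fm_val M \<phi> (case_nat a v) \<in> {0..1}" if "a \<in> mspace M" for a
    using that by (simp add: case_nat_in_valuations)
  obtain a where a: "a \<in> mspace M" using assms(1) by (auto simp: metric_structure_def)
  have "0 \<le> (SUP a\<in>mspace M. fm_val M \<phi> (case_nat a v))"
    by (rule cSUP_upper2[OF _ a]) (use * a in \<open>auto intro!: bdd_aboveI2[where M=1]\<close>)
  moreover have "(SUP a\<in>mspace M. fm_val M \<phi> (case_nat a v)) \<le> 1"
    by (rule cSUP_least) (use * a in auto)
  ultimately show ?case by simp
next
  case (FInf \<phi>)
  then have *: "fm_val M \<phi> (case_nat a v) \<in> {0..1}" if "a \<in> mspace M" for a
    using that by (simp add: case_nat_in_valuations)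
  obtain a where a: "a \<in> mspace M" using assms(1) by (auto simp: metric_structure_def)
  have "(INF a\<in>mspace M. fm_val M \<phi> (case_nat a v)) \<le> 1"
    by (rule cINF_lower2[OF _ a]) (use * a in \<open>auto intro!: bdd_belowI2[where m=0]\<close>)
  moreover have "0 \<le> (INF a\<in>mspace M. fm_val M \<phi> (case_nat a v))"
    by (rule cINF_greatest) (use * a in auto)
  ultimately show ?case by simp
qed

lemma fm_closure_wf:
  assumes "\<phi> \<in> fm_closure TYPE('u) T \<Delta>" and "\<And>\<psi>. \<psi> \<in> \<Delta> \<Longrightarrow> wf_fm \<psi>"
  shows "wf_fm \<phi>"
  using assms(1)
  by induction (auto simp: assms(2) wf_fm_rename lipschitz1_connective_def)

text \<open>The one-sided form matches one half of a correlation: totality or surjectivity supplies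
  the partner \<open>b\<close>. Two applications bound the difference of the suprema.\<close>

lemma cSUP_le_cSUP_add:
  fixes f :: "'a \<Rightarrow> real" and g :: "'b \<Rightarrow> real"
  assumes "A \<noteq> {}" "bdd_above (g ` B)" "\<And>a. a \<in> A \<Longrightarrow> \<exists>b\<in>B. f a \<le> g b + e"
  shows "(SUP a\<in>A. f a) \<le> (SUP b\<in>B. g b) + e"
proof (rule cSUP_least[OF assms(1)])
  fix a assume "a \<in> A"
  then obtain b where "b \<in> B" "f a \<le> g b + e" using assms(3) by blast
  moreover have "g b \<le> (SUP b\<in>B. g b)" using \<open>b \<in> B\<close> assms(2) by (rule cSUP_upper)
  ultimately show "f a \<le> (SUP b\<in>B. g b) + e" by linarith
qed

lemma cINF_le_cINF_add:
  fixes f :: "'a \<Rightarrow> real" and g :: "'b \<Rightarrow> real"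
  assumes "B \<noteq> {}" "bdd_below (f ` A)" "\<And>b. b \<in> B \<Longrightarrow> \<exists>a\<in>A. f a \<le> g b + e"
  shows "(INF a\<in>A. f a) \<le> (INF b\<in>B. g b) + e"
proof -
  have "(INF a\<in>A. f a) - e \<le> (INF b\<in>B. g b)"
  proof (rule cINF_greatest[OF assms(1)])
    fix b assume "b \<in> B"
    then obtain a where "a \<in> A" "f a \<le> g b + e" using assms(3) by blast
    moreover have "(INF a\<in>A. f a) \<le> f a" using assms(2) \<open>a \<in> A\<close> by (rule cINF_lower)
    ultimately show "(INF a\<in>A. f a) - e \<le> g b" by linarith
  qed
  then show ?thesis by linarith
qed

text \<open>Every closure rule preserves the bound: connectives are 1-Lipschitz for the sup metric,
  a quantified point can be replaced by a correlated one, and \<open>M\<close> and \<open>N\<close>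
  are both models over the type \<open>'u\<close> to which the rules \<open>equiv\<close> and
  \<open>limit\<close> refer.\<close>

lemma fm_closure_distortion:
  fixes M N :: "'u metric"
  assumes \<phi>: "\<phi> \<in> fm_closure TYPE('u) T \<Delta>"
    and wf: "\<And>\<psi>. \<psi> \<in> \<Delta> \<Longrightarrow> wf_fm \<psi>"
    and M: "models M T" and N: "models N T" and R: "correlation M N R"
    and \<Delta>: "\<And>\<psi> v w. \<psi> \<in> \<Delta> \<Longrightarrow> (\<And>i. (v i, w i) \<in> R) \<Longrightarrow> \<bar>fm_val M \<psi> v - fm_val N \<psi> w\<bar> \<le> e"
    and vw: "\<And>i. (v i, w i) \<in> R"
  shows "\<bar>fm_val M \<phi> v - fm_val N \<phi> w\<bar> \<le> e"
  using \<phi> vw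
proof (induction \<phi> arbitrary: v w)
  case (base \<phi>)
  then show ?case by (rule \<Delta>)
next
  case (ren \<phi> \<sigma>)
  then show ?case by (simp add: fm_val_rename)
next
  case (sup \<phi>)
  have v: "v \<in> valuations M" and w: "w \<in> valuations N"
    using sup.prems R by (auto simp: valuations_def correlation_def)
  have M': "metric_structure M" and N': "metric_structure N"
    using M N by (auto simp: models_def)
  have ne: "mspace M \<noteq> {}" "mspace N \<noteq> {}" using M' N' by (auto simp: metric_structure_def)
  have wf\<phi>: "wf_fm \<phi>" using sup.hyps wf by (rule fm_closure_wf)
  have bM: "bdd_above ((\<lambda>a. fm_val M \<phi> (case_nat a v)) ` mspace M)"
    using fm_val_unit_interval[OF M' wf\<phi> case_nat_in_valuations[OF _ v]]
    by (auto intro!: bdd_aboveI2[where M=1])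
  have bN: "bdd_above ((\<lambda>a. fm_val N \<phi> (case_nat a w)) ` mspace N)"
    using fm_val_unit_interval[OF N' wf\<phi> case_nat_in_valuations[OF _ w]]
    by (auto intro!: bdd_aboveI2[where M=1])
  \<comment> \<open>A correlated pair placed in front of pointwise correlated valuations gives
    pointwise correlated valuations, so the induction hypothesis applies.\<close>
  have step: "\<bar>fm_val M \<phi> (case_nat a v) - fm_val N \<phi> (case_nat b w)\<bar> \<le> e" if "(a, b) \<in> R" for a b
    by (rule sup.IH) (use that sup.prems in \<open>auto split: nat.splits\<close>)
  have "(SUP a\<in>mspace M. fm_val M \<phi> (case_nat a v)) \<le> (SUP b\<in>mspace N. fm_val N \<phi> (case_nat b w)) + e"
  proof (rule cSUP_le_cSUP_add[OF ne(1) bN])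
    fix a assume "a \<in> mspace M"
    then obtain b where "(a, b) \<in> R" "b \<in> mspace N" using R unfolding correlation_def by blast
    with step[of a b] show "\<exists>b\<in>mspace N. fm_val M \<phi> (case_nat a v) \<le> fm_val N \<phi> (case_nat b w) + e"
      by (intro bexI[of _ b]) auto
  qed
  moreover have "(SUP b\<in>mspace N. fm_val N \<phi> (case_nat b w)) \<le> (SUP a\<in>mspace M. fm_val M \<phi> (case_nat a v)) + e"
  proof (rule cSUP_le_cSUP_add[OF ne(2) bM])
    fix b assume "b \<in> mspace N"
    then obtain a where "(a, b) \<in> R" "a \<in> mspace M" using R unfolding correlation_def by blast
    with step[of a b] show "\<exists>a\<in>mspace M. fm_val N \<phi> (case_nat b w) \<le> fm_val M \<phi> (case_nat a v) + e"
      by (intro bexI[of _ a]) auto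
  qed
  ultimately show ?case by simp
next
  case (inf \<phi>)
  have v: "v \<in> valuations M" and w: "w \<in> valuations N"
    using inf.prems R by (auto simp: valuations_def correlation_def)
  have M': "metric_structure M" and N': "metric_structure N"
    using M N by (auto simp: models_def)
  have ne: "mspace M \<noteq> {}" "mspace N \<noteq> {}" using M' N' by (auto simp: metric_structure_def)
  have wf\<phi>: "wf_fm \<phi>" using inf.hyps wf by (rule fm_closure_wf)
  have bM: "bdd_below ((\<lambda>a. fm_val M \<phi> (case_nat a v)) ` mspace M)"
    using fm_val_unit_interval[OF M' wf\<phi> case_nat_in_valuations[OF _ v]]
    by (auto intro!: bdd_belowI2[where m=0])
  have bN: "bdd_below ((\<lambda>a. fm_val N \<phi> (case_nat a w)) ` mspace N)"
    using fm_val_unit_interval[OF N' wf\<phi> case_nat_in_valuations[OF _ w]]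
    by (auto intro!: bdd_belowI2[where m=0])
  have step: "\<bar>fm_val M \<phi> (case_nat a v) - fm_val N \<phi> (case_nat b w)\<bar> \<le> e" if "(a, b) \<in> R" for a b
    by (rule inf.IH) (use that inf.prems in \<open>auto split: nat.splits\<close>)
  have "(INF a\<in>mspace M. fm_val M \<phi> (case_nat a v)) \<le> (INF b\<in>mspace N. fm_val N \<phi> (case_nat b w)) + e"
  proof (rule cINF_le_cINF_add[OF ne(2) bM])
    fix b assume "b \<in> mspace N"
    then obtain a where "(a, b) \<in> R" "a \<in> mspace M" using R unfolding correlation_def by blast
    with step[of a b] show "\<exists>a\<in>mspace M. fm_val M \<phi> (case_nat a v) \<le> fm_val N \<phi> (case_nat b w) + e"
      by (intro bexI[of _ a]) auto
  qed
  moreover have "(INF b\<in>mspace N. fm_val N \<phi> (case_nat b w)) \<le> (INF a\<in>mspace M. fm_val M \<phi> (case_nat a v)) + e"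
  proof (rule cINF_le_cINF_add[OF ne(1) bN])
    fix a assume "a \<in> mspace M"
    then obtain b where "(a, b) \<in> R" "b \<in> mspace N" using R unfolding correlation_def by blast
    with step[of a b] show "\<exists>b\<in>mspace N. fm_val N \<phi> (case_nat b w) \<le> fm_val M \<phi> (case_nat a v) + e"
      by (intro bexI[of _ b]) auto
  qed
  ultimately show ?case by simp
next
  case (conn F \<phi>s)
  have v: "v \<in> valuations M" and w: "w \<in> valuations N"
    using conn.prems R by (auto simp: valuations_def correlation_def)
  let ?x = "\<lambda>i. fm_val M (\<phi>s i) v" and ?y = "\<lambda>i. fm_val N (\<phi>s i) w"
  have wf\<phi>: "wf_fm (\<phi>s i)" for i using conn.hyps(2) wf by (rule fm_closure_wf)
  have "?x \<in> unit_cube" "?y \<in> unit_cube"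
    using M N fm_val_unit_interval[OF _ wf\<phi>] v w unfolding models_def unit_cube_def by blast+
  then have "\<bar>F ?x - F ?y\<bar> \<le> (SUP i. \<bar>?x i - ?y i\<bar>)"
    using conn.hyps(1) by (simp add: lipschitz1_connective_def)
  also have "\<dots> \<le> e" by (rule cSUP_least) (use conn.IH conn.prems in auto)
  finally show ?case by simp
next
  case (equiv \<phi> \<psi>)
  have "v \<in> valuations M" "w \<in> valuations N"
    using equiv.prems R by (auto simp: valuations_def correlation_def)
  then show ?case using equiv.hyps(3)[OF M] equiv.hyps(3)[OF N] equiv.IH[OF equiv.prems] by simp
next
  case (limit \<phi>s \<psi>)
  have "v \<in> valuations M" "w \<in> valuations N"
    using limit.prems R by (auto simp: valuations_def correlation_def)
  \<comment> \<open>Uniform convergence is evaluated at the two points \<open>(M, v)\<close> and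
    \<open>(N, w)\<close>; a bound by \<open>e\<close> is a closed condition and passes to the
    limit.\<close>
  then have "(\<lambda>n. fm_val M (\<phi>s n) v) \<longlonglongrightarrow> fm_val M \<psi> v" "(\<lambda>n. fm_val N (\<phi>s n) w) \<longlonglongrightarrow> fm_val N \<psi> w"
    using tendsto_uniform_limitI[OF limit.hyps(3), of "(M, v)"]
      tendsto_uniform_limitI[OF limit.hyps(3), of "(N, w)"] M N by auto
  then have "(\<lambda>n. \<bar>fm_val M (\<phi>s n) v - fm_val N (\<phi>s n) w\<bar>) \<longlonglongrightarrow> \<bar>fm_val M \<psi> v - fm_val N \<psi> w\<bar>"
    by (intro tendsto_intros)
  then show ?case
    by (rule LIMSEQ_le_const2) (use limit.IH limit.prems in blast)
qed

section \<open>Separable models of \<open>DU\<close>\<close>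

lemma cSUP_eq_0D:
  fixes f :: "'a \<Rightarrow> real"
  assumes "(SUP a\<in>A. f a) = 0" "\<And>a. a \<in> A \<Longrightarrow> f a \<in> {0..1}" "a \<in> A"
  shows "f a = 0"
proof -
  have "f a \<le> (SUP a\<in>A. f a)"
    by (rule cSUP_upper[OF assms(3)]) (use assms(2) in \<open>auto intro!: bdd_aboveI2[where M=1]\<close>)
  with assms show ?thesis by force
qed

lemma continuous_on_proj_nat: "continuous_on S (\<lambda>t :: nat \<Rightarrow> real. t i)"
  by (rule continuous_on_product_coordinates[THEN continuous_on_subset]) auto

text \<open>Truth values are nonnegative, so a supremum equal to 0 forces every instance to be 0.
  Repeated use strips the outer \<open>FSup\<close> quantifiers of an axiom.\<close>

lemma models_FSupD:
  assumes "metric_structure M" "wf_fm \<phi>" "\<And>v. v \<in> valuations M \<Longrightarrow> fm_val M (FSup \<phi>) v = 0"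
    "v \<in> valuations M"
  shows "fm_val M \<phi> v = 0"
proof -
  have v: "v \<circ> Suc \<in> valuations M" "v 0 \<in> mspace M" using assms(4) by (auto simp: valuations_def)
  have "fm_val M \<phi> (case_nat (v 0) (v \<circ> Suc)) = 0"
    using assms(3)[OF v(1)] fm_val_unit_interval[OF assms(1,2) case_nat_in_valuations[OF _ v(1)]] v(2)
    by (intro cSUP_eq_0D[where A="mspace M" and f="\<lambda>a. fm_val M \<phi> (case_nat a (v \<circ> Suc))"]) auto
  moreover have "case_nat (v 0) (v \<circ> Suc) = v" by (auto simp: fun_eq_iff split: nat.splits)
  ultimately show ?thesis by simp
qed

lemma DU_ultrametric:
  assumes M: "models M DU" and xyz: "x \<in> mspace M" "y \<in> mspace M" "z \<in> mspace M"
  shows "mdist M x z \<le> max (mdist M x y) (mdist M y z)"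
proof -
  have M': "metric_structure M" using M by (simp add: models_def)
  define \<phi> where "\<phi> = FConn (\<lambda>t. max 0 (t 0 - max (t 1) (t 2)))
       (\<lambda>i. if i = 0 then FDist 2 0 else if i = 1 then FDist 2 1 else FDist 1 0)"
  have "connective (\<lambda>t. max 0 (t 0 - max (t 1) (t 2)))"
    unfolding connective_def
    by (intro conjI continuous_intros continuous_on_proj_nat)
      (auto simp: unit_cube_def max_def, (smt (verit, best))+)
  then have wf: "wf_fm \<phi>" by (simp add: \<phi>_def)
  have "fm_val M (FSup (FSup (FSup \<phi>))) v = 0" if "v \<in> valuations M" for v
    using M that unfolding models_def DU_def ultrametric_axiom_def \<phi>_def by blast
  then have *: "fm_val M \<phi> v = 0" if "v \<in> valuations M" for v
    using that by (metis models_FSupD[OF M'] wf wf_fm.simps(3))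
  \<comment> \<open>Indices 0, 1, 2 receive \<open>z\<close>, \<open>y\<close>, \<open>x\<close>, in
    accordance with the binding order of the axiom.\<close>
  have "fm_val M \<phi> (case_nat z (case_nat y (\<lambda>_. x))) = 0"
    by (rule *) (use xyz in \<open>auto simp: valuations_def split: nat.splits\<close>)
  then show ?thesis by (simp add: \<phi>_def numeral_2_eq_2 max_def split: if_splits)
qed

text \<open>The axioms speak of rational \<open>p\<close> and of an infimum that need not be
  attained; a rational strictly between \<open>a\<close> and \<open>b\<close> leaves a margin
  \<open>min (p - a) (b - p)\<close> for the error.\<close>

lemma DU_dense_distances:
  assumes M: "models M DU" and x: "x \<in> mspace M" and ab: "0 \<le> a" "a < b" "b \<le> 1"
  shows "\<exists>y\<in>mspace M. a < mdist M x y \<and> mdist M x y < b"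
proof -
  have M': "metric_structure M" using M by (simp add: models_def)
  obtain p where p: "p \<in> \<rat>" "a < p" "p < b" using Rats_dense_in_real[OF ab(2)] by blast
  define \<phi> where "\<phi> = FConn (\<lambda>t. \<bar>t 0 - p\<bar>) (\<lambda>_. FDist 1 0)"
  have "connective (\<lambda>t. \<bar>t 0 - p\<bar>)"
    unfolding connective_def
    by (intro conjI continuous_intros continuous_on_proj_nat)
      (use p ab in \<open>auto simp: unit_cube_def abs_le_iff\<close>, (smt (verit, best))+)
  then have wf: "wf_fm (FInf \<phi>)" by (simp add: \<phi>_def)
  have "dense_distance_axiom p \<in> DU" using p ab by (auto simp: DU_def)
  then have "fm_val M (FSup (FInf \<phi>)) v = 0" if "v \<in> valuations M" for v
    using M that unfolding models_def dense_distance_axiom_def \<phi>_def by blast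
  \<comment> \<open>Index 0 here is the variable of the outer supremum; below the infimum it becomes
    index 1.\<close>
  then have "fm_val M (FInf \<phi>) (\<lambda>_. x) = 0"
    by (rule models_FSupD[OF M' wf]) (use x in \<open>auto simp: valuations_def\<close>)
  then have inf: "(INF y\<in>mspace M. \<bar>mdist M x y - p\<bar>) = 0" by (simp add: \<phi>_def)
  have "(INF y\<in>mspace M. \<bar>mdist M x y - p\<bar>) < min (p - a) (b - p)" using inf p by simp
  then obtain y where "y \<in> mspace M" "\<bar>mdist M x y - p\<bar> < min (p - a) (b - p)"
    by (subst (asm) cINF_less_iff) (use x in \<open>auto intro!: bdd_belowI2[where m=0]\<close>)
  then show ?thesis by (intro bexI[of _ y]) auto
qed

section \<open>Closed balls as equivalence classes and their subdivision\<close>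

text \<open>Every point of an ultrametric ball is a centre of it. Closed balls of radius
  \<open>r\<close> thus represent the classes of the relation of being at distance at most
  \<open>r\<close>.\<close>

lemma DU_ball_eq_iff:
  assumes M: "models M DU" and xy: "x \<in> mspace M" "y \<in> mspace M" and r: "0 \<le> r"
  shows "{z \<in> mspace M. mdist M x z \<le> r} = {z \<in> mspace M. mdist M y z \<le> r} \<longleftrightarrow> mdist M x y \<le> r"
proof
  assume "{z \<in> mspace M. mdist M x z \<le> r} = {z \<in> mspace M. mdist M y z \<le> r}"
  moreover have "y \<in> {z \<in> mspace M. mdist M y z \<le> r}"
    using xy r by (simp add: Metric_space.mdist_zero[OF Metric_space_mspace_mdist])
  ultimately show "mdist M x y \<le> r" by blast
next
  assume "mdist M x y \<le> r"
  then show "{z \<in> mspace M. mdist M x z \<le> r} = {z \<in> mspace M. mdist M y z \<le> r}"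
    using DU_ultrametric[OF M xy] DU_ultrametric[OF M xy(2,1)] mdist_commute[of M x y]
    by (auto simp: max_def) (smt (verit, best))+
qed

text \<open>A countable dense set comes within \<open>r\<close> of every point, and \<open>B\<close>
  does not distinguish points that close, so its values on the dense set exhaust its image.\<close>

lemma separable_countable_balls:
  assumes "separable_space (mtopology_of M)" "0 < r"
    and eq: "\<And>x y. x \<in> mspace M \<Longrightarrow> y \<in> mspace M \<Longrightarrow> mdist M x y \<le> r \<Longrightarrow> B x = B y"
  shows "countable (B ` mspace M)"
proof -
  obtain C where C: "countable C" "C \<subseteq> mspace M" "mtopology_of M closure_of C = mspace M"
    using assms(1) by (auto simp: separable_space_def)
  have "B ` mspace M \<subseteq> B ` C"
  proof
    fix S assume "S \<in> B ` mspace M"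
    then obtain x where x: "x \<in> mspace M" "S = B x" by blast
    then have "x \<in> Metric_space.mtopology (mspace M) (mdist M) closure_of C"
      using C(3) by (simp add: mtopology_of_def)
    then obtain c where "c \<in> C" "c \<in> mspace M" "mdist M x c < r"
      using assms(2) by (auto simp: Metric_space.metric_closure_of Metric_space.in_mball)
    then show "S \<in> B ` C" using x eq[of x c] by auto
  qed
  then show ?thesis using C(1) by (meson countable_image countable_subset)
qed

text \<open>Density of distances yields a sequence of points whose distances from \<open>x\<close>
  decrease strictly inside the interval from \<open>r\<close> to \<open>s\<close>; no two of them
  share a class.\<close>

lemma DU_infinite_balls:
  assumes M: "models M DU" and x: "x \<in> mspace M" and rs: "0 \<le> r" "r < s" "s \<le> 1"
    and inj: "\<And>y z. y \<in> mspace M \<Longrightarrow> z \<in> mspace M \<Longrightarrow> B y = B z \<Longrightarrow> mdist M y z \<le> r"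
  shows "infinite (B ` {y \<in> mspace M. mdist M x y \<le> s})"
proof -
  \<comment> \<open>These thresholds start at \<open>u 0 = s\<close> and decrease towards
    \<open>r\<close>; each of the disjoint open intervals between consecutive ones contains a
    distance from \<open>x\<close>.\<close>
  define u where "u n = r + (s - r) / (real n + 1)" for n
  have u: "r < u n" "u n \<le> s" "u (Suc n) < u n" for n
    using rs by (auto simp: u_def field_simps mult_right_mono)
  have "\<exists>y\<in>mspace M. u (Suc n) < mdist M x y \<and> mdist M x y < u n" for n
    using DU_dense_distances[OF M x] u[of n] u[of "Suc n"] rs by auto
  then obtain b where b: "\<And>n. b n \<in> mspace M" "\<And>n. u (Suc n) < mdist M x (b n)"
    "\<And>n. mdist M x (b n) < u n" by metis
  have dec: "u n \<le> u m" if "m \<le> n" for m n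
    using that by (rule lift_Suc_antimono_le[rotated]) (use u in \<open>auto intro: less_imp_le\<close>)
  \<comment> \<open>By the isosceles property, points at distinct distances \<open>> r\<close> from \<open>x\<close> are more than \<open>r\<close> apart.\<close>
  have ne: "B (b m) \<noteq> B (b n)" if "m < n" for m n
  proof
    assume "B (b m) = B (b n)"
    then have "mdist M (b n) (b m) \<le> r" using b inj by metis
    moreover have "mdist M x (b m) \<le> max (mdist M x (b n)) (mdist M (b n) (b m))"
      by (rule DU_ultrametric[OF M x b(1) b(1)])
    moreover have "mdist M x (b n) < mdist M x (b m)"
      using b(3)[of n] dec[of "Suc m" n] b(2)[of m] that by auto
    moreover have "r < mdist M x (b n)" using u(1)[of "Suc n"] b(2)[of n] by linarith
    ultimately show False by auto
  qed
  have "inj (\<lambda>n. B (b n))"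
    by (rule injI) (metis ne linorder_neqE_nat)
  then have "infinite (range (\<lambda>n. B (b n)))" by (rule range_inj_infinite)
  moreover have "range (\<lambda>n. B (b n)) \<subseteq> B ` {y \<in> mspace M. mdist M x y \<le> s}"
    using b u(2) by (auto intro!: imageI) (meson less_le_trans less_imp_le)
  ultimately show ?thesis using finite_subset by blast
qed

text \<open>Each class of radius \<open>s\<close> has countably many subclasses of radius
  \<open>r\<close> by separability and infinitely many by density of distances, so they can be
  numbered bijectively by the naturals.\<close>

lemma DU_subclass_numbering:
  assumes M: "models M DU" and sep: "separable_space (mtopology_of M)"
    and rs: "0 < r" "r < s" "s \<le> 1"
  shows "\<exists>f :: 'u \<Rightarrow> nat. \<forall>x\<in>mspace (M :: 'u metric).
     (\<forall>y\<in>mspace M. mdist M x y \<le> s \<longrightarrow> (f x = f y \<longleftrightarrow> mdist M x y \<le> r)) \<and>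
     (\<forall>n. \<exists>y\<in>mspace M. mdist M x y \<le> s \<and> f y = n)"
proof -
  define B where "B t x = {z \<in> mspace M. mdist M x z \<le> t}" for t x
  have B: "B t x = B t y \<longleftrightarrow> mdist M x y \<le> t" if "x \<in> mspace M" "y \<in> mspace M" "0 \<le> t" for x y t
    unfolding B_def using DU_ball_eq_iff[OF M that] .
  have "countable (B r ` mspace M)"
    by (rule separable_countable_balls[OF sep rs(1)]) (use B rs in auto)
  then have cnt: "countable (B r ` B s x)" for x
    by (rule countable_subset[rotated]) (auto simp: B_def)
  have inf: "infinite (B r ` B s x)" if "x \<in> mspace M" for x
    unfolding B_def[of s] by (rule DU_infinite_balls[OF M that, of r]) (use B rs in auto)
  \<comment> \<open>The enumeration depends on \<open>x\<close> only through its class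
    \<open>B s x\<close>, so all points of that class share one numbering. Numberings of different
    classes are unrelated.\<close>
  define f where "f x = to_nat_on (B r ` B s x) (B r x)" for x
  have bij: "bij_betw (to_nat_on (B r ` B s x)) (B r ` B s x) UNIV" if "x \<in> mspace M" for x
    using to_nat_on_infinite[OF cnt inf[OF that]] .
  show ?thesis
  proof (intro exI[of _ f] ballI conjI allI impI)
    fix x y assume xy: "x \<in> mspace M" "y \<in> mspace M" "mdist M x y \<le> s"
    then have Bs: "B s y = B s x" using B rs by (metis less_imp_le less_trans)
    have "x \<in> B s x" "y \<in> B s x"
      using xy rs by (auto simp: B_def Metric_space.mdist_zero[OF Metric_space_mspace_mdist])
    then have "B r x \<in> B r ` B s x" "B r y \<in> B r ` B s x" by auto
    then have "f x = f y \<longleftrightarrow> B r x = B r y"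
      unfolding f_def Bs using inj_on_eq_iff[OF bij_betw_imp_inj_on[OF bij[OF xy(1)]]] by blast
    then show "f x = f y \<longleftrightarrow> mdist M x y \<le> r" using B[OF xy(1,2)] rs by simp
  next
    fix x n assume x: "x \<in> mspace M"
    have "n \<in> to_nat_on (B r ` B s x) ` (B r ` B s x)" using bij_betw_imp_surj_on[OF bij[OF x]] by blast
    then obtain y where y: "y \<in> B s x" "n = to_nat_on (B r ` B s x) (B r y)" by blast
    then have "y \<in> mspace M" "mdist M x y \<le> s" by (auto simp: B_def)
    moreover from this have "B s x = B s y" using B x rs by (metis less_imp_le less_trans)
    ultimately show "\<exists>y\<in>mspace M. mdist M x y \<le> s \<and> f y = n" using y unfolding f_def by metis
  qed
qed

section \<open>Addresses and the correlation\<close>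

text \<open>\<open>f j x\<close> numbers the class of radius \<open>j / k\<close> of
  \<open>x\<close> inside its class of radius \<open>(j + 1) / k\<close>. The address of
  \<open>x\<close> is \<open>f 1 x, ..., f (k - 1) x\<close>; radius 1 gives a single class and
  needs no coordinate.\<close>

definition addressing :: "nat \<Rightarrow> 'u metric \<Rightarrow> (nat \<Rightarrow> 'u \<Rightarrow> nat) \<Rightarrow> bool" where
  "addressing k M f \<longleftrightarrow> (\<forall>j x. 1 \<le> j \<longrightarrow> j < k \<longrightarrow> x \<in> mspace M \<longrightarrow>
     (\<forall>y\<in>mspace M. mdist M x y \<le> real (Suc j) / real k \<longrightarrow>
        (f j x = f j y \<longleftrightarrow> mdist M x y \<le> real j / real k)) \<and>
     (\<forall>n. \<exists>y\<in>mspace M. mdist M x y \<le> real (Suc j) / real k \<and> f j y = n))"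

lemma DU_addressing_exists:
  assumes "models M DU" "separable_space (mtopology_of M)"
  shows "\<exists>f. addressing k M f"
proof -
  \<comment> \<open>The range condition on \<open>j\<close> sits inside \<open>P\<close>, so a
    \<open>g\<close> exists for every \<open>j\<close> and one function \<open>f\<close> can be
    chosen.\<close>
  define P where "P j g \<longleftrightarrow> (1 \<le> j \<longrightarrow> j < k \<longrightarrow> (\<forall>x\<in>mspace M.
     (\<forall>y\<in>mspace M. mdist M x y \<le> real (Suc j) / real k \<longrightarrow>
        (g x = g y \<longleftrightarrow> mdist M x y \<le> real j / real k)) \<and>
     (\<forall>n. \<exists>y\<in>mspace M. mdist M x y \<le> real (Suc j) / real k \<and> g y = n)))"
    for j and g :: "'a \<Rightarrow> nat"
  have "\<exists>g. P j g" for j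
  proof (cases "1 \<le> j \<and> j < k")
    case True
    then have "0 < real j / real k" "real j / real k < real (Suc j) / real k"
      "real (Suc j) / real k \<le> 1"
      by (auto simp: field_simps)
    from DU_subclass_numbering[OF assms this] show ?thesis unfolding P_def by blast
  qed (auto simp: P_def)
  then obtain f where "\<And>j. P j (f j)" by metis
  then show ?thesis unfolding addressing_def P_def by (intro exI[of _ f]) simp
qed

text \<open>Induction runs downwards from \<open>j = k\<close>, where both sides hold because
  distances are at most 1. Each step refines the class by the single coordinate
  \<open>j\<close>.\<close>

lemma addressing_dist_le_iff:
  assumes f: "addressing k M f" and M: "metric_structure M"
    and x: "x \<in> mspace M" and y: "y \<in> mspace M" and j: "1 \<le> j" "j \<le> k"
  shows "mdist M x y \<le> real j / real k \<longleftrightarrow> (\<forall>i\<in>{j..<k}. f i x = f i y)"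
  using j(2,1)
proof (induction j rule: inc_induct)
  case base
  then show ?case using M x y by (auto simp: metric_structure_def)
next
  case (step j)
  have IH: "mdist M x y \<le> real (Suc j) / real k \<longleftrightarrow> (\<forall>i\<in>{Suc j..<k}. f i x = f i y)"
    using step by simp
  have eq: "mdist M x y \<le> real (Suc j) / real k \<Longrightarrow> f j x = f j y \<longleftrightarrow> mdist M x y \<le> real j / real k"
    using f step x y unfolding addressing_def by blast
  have mono: "mdist M x y \<le> real j / real k \<Longrightarrow> mdist M x y \<le> real (Suc j) / real k"
    by (erule order_trans) (simp add: divide_right_mono)
  have "{j..<k} = insert j {Suc j..<k}" using step by auto
  then show ?case using IH eq mono by auto
qed

text \<open>Coordinates are prescribed from the coarsest level \<open>k - 1\<close> down to 1, each
  time by moving to another point in the current class.\<close>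

lemma addressing_surj:
  assumes f: "addressing k M f" and M: "metric_structure M" and k: "1 \<le> k"
  shows "\<exists>y\<in>mspace M. \<forall>i\<in>{1..<k}. f i y = c i"
  using k
proof (induction rule: inc_induct)
  case base
  then show ?case using M by (auto simp: metric_structure_def)
next
  case (step j)
  then obtain y where y: "y \<in> mspace M" "\<forall>i\<in>{Suc j..<k}. f i y = c i" by auto
  then obtain z where z: "z \<in> mspace M" "mdist M y z \<le> real (Suc j) / real k" "f j z = c j"
    using f step unfolding addressing_def by blast
  \<comment> \<open>The move from \<open>y\<close> to \<open>z\<close> stays in a class of radius
    \<open>(j + 1) / k\<close> and so keeps the coordinates already fixed.\<close>
  then have "\<forall>i\<in>{Suc j..<k}. f i y = f i z"
    using addressing_dist_le_iff[OF f M y(1) z(1), of "Suc j"] step by simp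
  moreover have "{j..<k} = insert j {Suc j..<k}" using step by auto
  ultimately show ?case using y z by (intro bexI[of _ z]) auto
qed

text \<open>Rounding \<open>b\<close> up to a grid point costs at most \<open>1 / k\<close>, and the
  grid hypothesis transfers that upper bound to \<open>a\<close>.\<close>

lemma le_add_if_grid_le:
  fixes a b :: real
  assumes k: "1 \<le> k" and a: "a \<le> 1" and b: "0 \<le> b" "b \<le> 1"
    and grid: "\<And>j. 1 \<le> j \<Longrightarrow> j \<le> k \<Longrightarrow> b \<le> real j / real k \<Longrightarrow> a \<le> real j / real k"
  shows "a \<le> b + 1 / real k"
proof -
  \<comment> \<open>Floor plus one, not the ceiling, keeps \<open>j\<close> at least 1 when
    \<open>b = 0\<close>. It exceeds \<open>k\<close> only when \<open>b = 1\<close>, and there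
    \<open>a \<le> 1\<close> suffices.\<close>
  define j where "j = Suc (nat \<lfloor>b * real k\<rfloor>)"
  have j: "real j = real_of_int \<lfloor>b * real k\<rfloor> + 1" using b by (simp add: j_def)
  have lo: "b * real k \<le> real j" and hi: "real j \<le> b * real k + 1" using j by linarith+
  have "real j / real k \<le> b + 1 / real k" using hi k by (simp add: field_simps)
  moreover have "a \<le> real j / real k"
  proof (cases "j \<le> k")
    case True
    then show ?thesis using grid[of j] lo k by (simp add: j_def field_simps)
  next
    case False
    then have "1 \<le> real j / real k" using k by (simp add: field_simps)
    with a show ?thesis by linarith
  qed
  ultimately show ?thesis by linarith
qed

lemma DU_correlation_exists:
  assumes M: "models M DU" "separable_space (mtopology_of M)"
    and N: "models N DU" "separable_space (mtopology_of N)" and k: "1 \<le> k"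
  shows "\<exists>R. correlation M N R \<and> (\<forall>(x, y)\<in>R. \<forall>(x', y')\<in>R. \<bar>mdist M x x' - mdist N y y'\<bar> \<le> 1 / real k)"
proof -
  obtain f g where f: "addressing k M f" and g: "addressing k N g"
    using DU_addressing_exists M N by metis
  have M': "metric_structure M" and N': "metric_structure N" using M N by (auto simp: models_def)
  define R where "R = {(x, y). x \<in> mspace M \<and> y \<in> mspace N \<and> (\<forall>i\<in>{1..<k}. f i x = g i y)}"
  have "\<exists>y. (x, y) \<in> R" if "x \<in> mspace M" for x
    using addressing_surj[OF g N' k, of "\<lambda>i. f i x"] that by (auto simp: R_def)
  moreover have "\<exists>x. (x, y) \<in> R" if "y \<in> mspace N" for y
    using addressing_surj[OF f M' k, of "\<lambda>i. g i y"] that by (auto simp: R_def)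
  ultimately have "correlation M N R" by (auto simp: correlation_def R_def)
  moreover have "\<bar>mdist M x x' - mdist N y y'\<bar> \<le> 1 / real k" if "(x, y) \<in> R" "(x', y') \<in> R" for x y x' y'
  proof -
    have in_space: "x \<in> mspace M" "x' \<in> mspace M" "y \<in> mspace N" "y' \<in> mspace N"
      using that by (auto simp: R_def)
    then have le1: "mdist M x x' \<le> 1" "mdist N y y' \<le> 1"
      using M' N' by (auto simp: metric_structure_def)
    \<comment> \<open>Correlated points have equal addresses, so \<open>x\<close> and
      \<open>x'\<close> agree in exactly the coordinates in which \<open>y\<close> and
      \<open>y'\<close> agree.\<close>
    have "mdist M x x' \<le> real j / real k \<longleftrightarrow> mdist N y y' \<le> real j / real k" if "1 \<le> j" "j \<le> k" for j
      using addressing_dist_le_iff[OF f M' in_space(1,2) that]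
        addressing_dist_le_iff[OF g N' in_space(3,4) that] \<open>(x, y) \<in> R\<close> \<open>(x', y') \<in> R\<close> that
      by (auto simp: R_def)
    then have "mdist M x x' \<le> mdist N y y' + 1 / real k" "mdist N y y' \<le> mdist M x x' + 1 / real k"
      using le_add_if_grid_le[OF k le1(1) _ le1(2)] le_add_if_grid_le[OF k le1(2) _ le1(1)] by auto
    then show ?thesis by linarith
  qed
  ultimately show ?thesis by blast
qed

section \<open>From small distortion to vanishing distance\<close>

text \<open>Since \<open>rho\<close> is an infimum, the correlation may vary with the bound
  \<open>1 / real (Suc n)\<close>; no single correlation of distortion 0 is sought.\<close>

lemma rho_closure_GH_eq_0:
  fixes M N :: "'u metric"
  assumes M: "models M DU" "separable_space (mtopology_of M)"
    and N: "models N DU" "separable_space (mtopology_of N)"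
  shows "rho (fm_closure TYPE('u) DU GH) M N = 0"
proof -
  have le: "rho (fm_closure TYPE('u) DU GH) M N \<le> ennreal (1 / real (Suc n))" for n
  proof -
    obtain R where R: "correlation M N R"
      and dist: "\<And>x y x' y'. (x, y) \<in> R \<Longrightarrow> (x', y') \<in> R \<Longrightarrow> \<bar>mdist M x x' - mdist N y y'\<bar> \<le> 1 / real (Suc n)"
      using DU_correlation_exists[OF M N, of "Suc n"] by fastforce
    have "distortion (fm_closure TYPE('u) DU GH) M N R \<le> ennreal (1 / real (Suc n))"
      unfolding distortion_def
    proof (rule Sup_least, clarify)
      fix \<phi> and v w :: "nat \<Rightarrow> 'u"
      assume \<phi>: "\<phi> \<in> fm_closure TYPE('u) DU GH" and vw: "\<forall>i. (v i, w i) \<in> R"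
      have "\<bar>fm_val M \<phi> v - fm_val N \<phi> w\<bar> \<le> 1 / real (Suc n)"
      proof (rule fm_closure_distortion[OF \<phi> _ M(1) N(1) R])
        show "wf_fm \<psi>" if "\<psi> \<in> GH" for \<psi> using that by (auto simp: GH_def)
        show "\<bar>fm_val M \<psi> v - fm_val N \<psi> w\<bar> \<le> 1 / real (Suc n)"
          if "\<psi> \<in> GH" "\<And>i. (v i, w i) \<in> R" for \<psi> v w
        proof -
          have "\<psi> = FDist 0 1" using that(1) by (simp add: GH_def)
          then show ?thesis using dist[OF that(2)[of 0] that(2)[of 1]] by (simp only: fm_val.simps)
        qed
      qed (use vw in blast)
      then show "ennreal \<bar>fm_val M \<phi> v - fm_val N \<phi> w\<bar> \<le> ennreal (1 / real (Suc n))"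
        by (rule ennreal_leI)
    qed
    moreover have "rho (fm_closure TYPE('u) DU GH) M N \<le> distortion (fm_closure TYPE('u) DU GH) M N R"
      unfolding rho_def by (rule Inf_lower) (use R in blast)
    ultimately show ?thesis by (rule order_trans[rotated])
  qed
  have "(\<lambda>n. ennreal (1 / real (Suc n))) \<longlonglongrightarrow> ennreal 0"
    by (rule tendsto_ennrealI) (rule LIMSEQ_Suc[OF lim_1_over_n])
  then have "rho (fm_closure TYPE('u) DU GH) M N \<le> ennreal 0"
    by (rule LIMSEQ_le_const) (use le in blast)
  then show ?thesis by simp
qed

text \<open>The two conjuncts cover both readings of separability: density character exactly omega,
  and the existence of a countable dense subset.\<close>

theorem theorem5p17:
  shows "strongly_omega_categorical TYPE('u) (fm_closure TYPE('u) DU GH) DU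
    \<and> (\<forall>(M :: 'u metric) (N :: 'u metric). models M DU \<longrightarrow> models N DU \<longrightarrow>
         separable_space (mtopology_of M) \<longrightarrow> separable_space (mtopology_of N) \<longrightarrow>
         rho (fm_closure TYPE('u) DU GH) M N = 0)"
  unfolding strongly_omega_categorical_def density_character_omega_def
  using rho_closure_GH_eq_0 by blast

end
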